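(* There exists an infinite family $\mathcal{F}$ of compact convex sets in $\mathbb{R}^3$ such that (a) $\mathcal{F}$ is one-unbounded; (b) $\mathcal{F}$ satisfies the $(\aleph_0,3)$-property with respect to lines; and (c) $\mathcal{F}$ does not have a finite line transversal, i.e. there is no finite set of lines such that every member of $\mathcal{F}$ meets one of them.
   Context: A collection $\mathbb{F}$ of compact convex sets has bounded diameter if there is $R>0$ with $\mathrm{diam}(C)<R$ for all $C\in\mathbb{F}$, and is unbounded if $\bigcup_{C\in\mathbb{F}}C$ is unbounded. For an unbounded collection $\mathbb{F}$ of compact convex sets with bounded diameter in $\mathbb{R}^d$, a vector $y\in\mathbb{S}^{d-1}$ is a limiting direction of $\mathbb{F}$ if there are pairwise distinct sets $S_n\in\mathbb{F}$ and points $s_n\in S_n$ ($n\in\mathbb{N}$) with $\|s_n\|\to\infty$ and $s_n/\|s_n\|\to y$. The limiting direction set $LDS(\mathbb{F})$ is the set of all limiting directions, and $\mathbb{F}$ is $k$-unbounded if the linear span of $LDS(\mathbb{F})$ has dimension at least $k$. A family satisfies the $(\aleph_0,3)$-property with respect to lines if among every infinite sequence of its members there are $3$ that are intersected by a single line. *)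

theory Defs
  imports "HOL-Analysis.Analysis"
begin

definition bounded_diameter :: "'a::euclidean_space set set \<Rightarrow> bool" where
  "bounded_diameter F \<longleftrightarrow> (\<exists>R>0. \<forall>C\<in>F. diameter C < R)"

definition unbounded_family :: "'a::euclidean_space set set \<Rightarrow> bool" where
  "unbounded_family F \<longleftrightarrow> \<not> bounded (\<Union>F)"

definition limiting_direction :: "'a::euclidean_space set set \<Rightarrow> 'a \<Rightarrow> bool" where
  "limiting_direction F y \<longleftrightarrow>
     y \<in> sphere 0 1 \<and>
     (\<exists>(S :: nat \<Rightarrow> 'a set) (s :: nat \<Rightarrow> 'a).
        inj S \<and> (\<forall>n. S n \<in> F) \<and> (\<forall>n. s n \<in> S n) \<and>
        filterlim (\<lambda>n. norm (s n)) at_top sequentially \<and>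
        (\<lambda>n. s n /\<^sub>R norm (s n)) \<longlonglongrightarrow> y)"

definition LDS :: "'a::euclidean_space set set \<Rightarrow> 'a set" where
  "LDS F = {y. limiting_direction F y}"

(* The notion only makes sense for unbounded collections with bounded diameter,
   so these two conditions are part of the definition. *)
definition k_unbounded :: "nat \<Rightarrow> 'a::euclidean_space set set \<Rightarrow> bool" where
  "k_unbounded k F \<longleftrightarrow>
     bounded_diameter F \<and> unbounded_family F \<and> dim (span (LDS F)) \<ge> k"

definition is_line :: "'a::euclidean_space set \<Rightarrow> bool" where
  "is_line L \<longleftrightarrow> affine L \<and> aff_dim L = 1"

(* Sequences consist of pairwise distinct members: a repeated member would be
   counted several times and make the property vacuous for that sequence. *)
definition aleph0_property_lines :: "nat \<Rightarrow> 'a::euclidean_space set set \<Rightarrow> bool" where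
  "aleph0_property_lines q F \<longleftrightarrow>
     (\<forall>S :: nat \<Rightarrow> 'a set. inj S \<and> (\<forall>n. S n \<in> F) \<longrightarrow>
        (\<exists>I. finite I \<and> card I = q \<and> (\<exists>L. is_line L \<and> (\<forall>i\<in>I. S i \<inter> L \<noteq> {}))))"

definition finite_line_transversal :: "'a::euclidean_space set set \<Rightarrow> bool" where
  "finite_line_transversal F \<longleftrightarrow>
     (\<exists>\<L>. finite \<L> \<and> (\<forall>L\<in>\<L>. is_line L) \<and> (\<forall>C\<in>F. \<exists>L\<in>\<L>. C \<inter> L \<noteq> {}))"

end

theory Submission
  imports Defs "HOL-Real_Asymp.Real_Asymp"
begin

text \<open>
  The family consists of segments, the \<open>n\<close>-th one in the plane \<open>x\<^sub>1 = n\<close>. Projected along the first axis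
  they become pieces of the tangents \<open>w = t u - t\<^sup>2\<close>, \<open>t = 1/(n+1)\<close>, of the parabola \<open>w = u\<^sup>2/4\<close>.
  The tangents with parameters \<open>s\<close> and \<open>t\<close> cross over \<open>u = s + t\<close>. For \<open>i < j < k\<close> take the points of the
  \<open>i\<close>-th and the \<open>k\<close>-th segment that project to the \<open>j\<close>-th tangent: the line through them meets the
  \<open>j\<close>-th segment. On the other hand, a line meeting infinitely many of the segments has bounded
  second and third coordinates along infinitely many integers, so it is parallel to the first axis;
  it then projects to a single point, which lies on at most two of the tangents.
\<close>

section \<open>Segments cut from the tangents of a parabola\<close>

definition tangent_parameter :: "nat \<Rightarrow> real" where
  "tangent_parameter n = 1 / (real n + 1)"

definition tangent_point :: "nat \<Rightarrow> real \<Rightarrow> real ^ 3" where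
  "tangent_point n u =
     vector [real n, u, tangent_parameter n * u - (tangent_parameter n)\<^sup>2]"

text \<open>The range from 0 to 2 contains every crossing \<open>s + t\<close>, because all
  parameters lie between 0 and 1.\<close>

definition tangent_segment :: "nat \<Rightarrow> (real ^ 3) set" where
  "tangent_segment n = closed_segment (tangent_point n 0) (tangent_point n 2)"

lemma tangent_point_nth [simp]:
  "tangent_point n u $ 1 = real n"
  "tangent_point n u $ 2 = u"
  "tangent_point n u $ 3 = tangent_parameter n * u - (tangent_parameter n)\<^sup>2"
  by (simp_all add: tangent_point_def)

lemma tangent_parameter_bounds: "0 < tangent_parameter n" "tangent_parameter n \<le> 1"
  by (simp_all add: tangent_parameter_def)

lemma inj_tangent_parameter: "inj tangent_parameter"
  by (rule injI) (simp add: tangent_parameter_def)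

text \<open>\<open>tangent_point n\<close> is affine in \<open>u\<close>, so it carries the interval
  onto the segment between the images of its endpoints.\<close>

lemma tangent_segment_eq: "tangent_segment n = tangent_point n ` {0..2}"
proof -
  have *: "(1 - c) *\<^sub>R tangent_point n 0 + c *\<^sub>R tangent_point n 2 = tangent_point n (2 * c)" for c
    by (simp add: vec_eq_iff forall_3 algebra_simps)
  show ?thesis
  proof (intro set_eqI iffI)
    fix p assume "p \<in> tangent_segment n"
    then obtain c where "0 \<le> c" "c \<le> 1" "p = tangent_point n (2 * c)"
      by (auto simp: tangent_segment_def in_segment *)
    then show "p \<in> tangent_point n ` {0..2}" by auto
  next
    fix p assume "p \<in> tangent_point n ` {0..2}"
    then obtain u where u: "0 \<le> u" "u \<le> 2" "p = tangent_point n u" by auto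
    then show "p \<in> tangent_segment n"
      unfolding tangent_segment_def in_segment * by (intro exI [of _ "u / 2"]) auto
  qed
qed

lemma tangent_segmentE:
  assumes "p \<in> tangent_segment n"
  obtains u where "0 \<le> u" "u \<le> 2" "p = tangent_point n u"
  using assms by (auto simp: tangent_segment_eq)

lemma inj_tangent_segment: "inj tangent_segment"
proof (rule injI)
  fix m n assume "tangent_segment m = tangent_segment n"
  moreover have "tangent_point m 0 \<in> tangent_segment m"
    by (simp add: tangent_segment_def)
  ultimately have "tangent_point m 0 \<in> tangent_segment n" by simp
  then obtain u where "tangent_point m 0 = tangent_point n u" by (rule tangent_segmentE)
  then have "tangent_point m 0 $ 1 = tangent_point n u $ 1" by simp
  then show "m = n" by simp
qed

lemma diameter_tangent_segment: "diameter (tangent_segment n) \<le> 4"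
proof (rule diameter_le)
  let ?t = "tangent_parameter n"
  fix p q assume "p \<in> tangent_segment n" "q \<in> tangent_segment n"
  then obtain u v where uv: "0 \<le> u" "u \<le> 2" "0 \<le> v" "v \<le> 2"
    and pq: "p = tangent_point n u" "q = tangent_point n v"
    by (metis tangent_segmentE)
  \<comment> \<open>In the l1 norm the first coordinates cancel, and a slope of at most 1 leaves 2 +
    2.\<close>
  have "norm (p - q) \<le> (\<Sum>i\<in>UNIV. \<bar>(p - q) $ i\<bar>)"
    by (rule norm_le_l1_cart)
  also have "\<dots> = \<bar>u - v\<bar> + ?t * \<bar>u - v\<bar>"
    using tangent_parameter_bounds[of n]
    by (simp add: sum_3 pq abs_mult flip: right_diff_distrib)
  also have "\<dots> \<le> 2 + 1 * 2"
    using tangent_parameter_bounds[of n] uv by (intro add_mono mult_mono) auto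
  finally show "norm (p - q) \<le> 4" by simp
qed simp

section \<open>One-unboundedness along the first axis\<close>

lemma norm_tangent_point_0:
  "norm (tangent_point n 0) = sqrt ((real n)\<^sup>2 + (1 / (real n + 1))^4)"
  by (simp add: norm_vec_def L2_set_def sum_3 tangent_parameter_def)

lemma tangent_point_at_top: "filterlim (\<lambda>n. norm (tangent_point n 0)) at_top sequentially"
  unfolding norm_tangent_point_0 by real_asymp

lemma tangent_point_direction:
  "(\<lambda>n. tangent_point n 0 /\<^sub>R norm (tangent_point n 0)) \<longlonglongrightarrow> axis 1 1"
proof (rule vec_tendstoI)
  \<comment> \<open>These are the limits of the first and third coordinates; the second vanishes
    because \<open>u = 0\<close>.\<close>
  have 1: "(\<lambda>n. inverse (sqrt ((real n)\<^sup>2 + (1 / (real n + 1))^4)) * real n) \<longlonglongrightarrow> 1"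
    by real_asymp
  have 3: "(\<lambda>n. inverse (sqrt ((real n)\<^sup>2 + (1 / (real n + 1))^4)) * (- (1 / (real n + 1))\<^sup>2)) \<longlonglongrightarrow> 0"
    by real_asymp
  fix i :: 3
  show "(\<lambda>n. (tangent_point n 0 /\<^sub>R norm (tangent_point n 0)) $ i) \<longlonglongrightarrow> axis 1 1 $ i"
    using exhaust_3[of i] 1 3
    by (auto simp: axis_def norm_tangent_point_0 tangent_parameter_def)
qed

lemma k_unbounded_tangent_segments: "k_unbounded 1 (range tangent_segment)"
proof -
  have mem: "tangent_point n 0 \<in> tangent_segment n" for n
    by (simp add: tangent_segment_def)
  have "bounded_diameter (range tangent_segment)"
    unfolding bounded_diameter_def
    by (intro exI [of _ 5]) (auto intro: le_less_trans [OF diameter_tangent_segment])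
  moreover have "unbounded_family (range tangent_segment)"
    unfolding unbounded_family_def
  proof
    assume "bounded (\<Union> (range tangent_segment))"
    then obtain B where "\<forall>p\<in>\<Union> (range tangent_segment). norm p \<le> B"
      by (auto simp: bounded_iff)
    then have "norm (tangent_point n 0) \<le> B" for n
      using mem by blast
    moreover have "\<forall>\<^sub>F n in sequentially. norm (tangent_point n 0) > B"
      using tangent_point_at_top by (simp add: filterlim_at_top_dense)
    then obtain n where "norm (tangent_point n 0) > B"
      by (auto simp: eventually_sequentially)
    ultimately show False by (meson not_le)
  qed
  moreover have "axis 1 1 \<in> LDS (range tangent_segment)"
    using tangent_point_at_top tangent_point_direction inj_tangent_segment mem
    unfolding LDS_def limiting_direction_def
    by (auto intro!: exI [of _ tangent_segment] exI [of _ "\<lambda>n. tangent_point n 0"])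
  \<comment> \<open>Dimension 0 would put the set inside \<open>{0}\<close>, but
    \<open>axis 1 1\<close> is nonzero.\<close>
  then have "dim (LDS (range tangent_segment)) \<noteq> 0"
    by auto
  ultimately show ?thesis by (simp add: k_unbounded_def del: dim_eq_0)
qed

section \<open>Common lines for triples\<close>

lemma three_tangent_segments_transversal:
  assumes "i < j" "j < k"
  obtains L where "is_line L" "tangent_segment i \<inter> L \<noteq> {}" "tangent_segment j \<inter> L \<noteq> {}"
    "tangent_segment k \<inter> L \<noteq> {}"
proof -
  define r s t where "r = tangent_parameter k" and "s = tangent_parameter i"
    and "t = tangent_parameter j"
  note bounds = tangent_parameter_bounds[of i, folded s_def]
    tangent_parameter_bounds[of j, folded t_def] tangent_parameter_bounds[of k, folded r_def]
  \<comment> \<open>The \<open>j\<close>-th tangent crosses the \<open>i\<close>-th over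
    \<open>s + t\<close> and the \<open>k\<close>-th over \<open>r + t\<close>.\<close>
  define p q where "p = tangent_point i (s + t)" and "q = tangent_point k (r + t)"
  \<comment> \<open>The ratio at which the line from \<open>p\<close> to \<open>q\<close> reaches
    the plane of the \<open>j\<close>-th segment.\<close>
  define c where "c = (real j - real i) / (real k - real i)"
  have c: "0 \<le> c" "c \<le> 1" "real j = (1 - c) * real i + c * real k"
  proof -
    have "c * (real k - real i) = real j - real i" using assms by (simp add: c_def)
    then show "real j = (1 - c) * real i + c * real k" by (simp add: algebra_simps)
  qed (use assms in \<open>auto simp: c_def field_simps\<close>)
  define u where "u = (1 - c) * (s + t) + c * (r + t)"
  have "u \<in> {0..2}"
  proof -
    have "(1 - c) *\<^sub>R (s + t) + c *\<^sub>R (r + t) \<in> {0..2}"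
      using c bounds by (intro convexD convex_real_interval) auto
    then show ?thesis by (simp add: u_def)
  qed
  \<comment> \<open>The first coordinate is right by the choice of \<open>c\<close>, the second by
    that of \<open>u\<close>. The third agrees because \<open>p\<close> and \<open>q\<close> both
    project to the \<open>j\<close>-th tangent, hence so do their affine combinations.\<close>
  have "tangent_point j u = (1 - c) *\<^sub>R p + c *\<^sub>R q"
    using c(3)
    by (simp add: vec_eq_iff forall_3 p_def q_def u_def flip: r_def s_def t_def)
      (simp add: algebra_simps power2_eq_square)
  then have "tangent_point j u \<in> affine hull {p, q}"
    unfolding affine_hull_2 by force
  moreover have "p $ 1 \<noteq> q $ 1" using assms by (simp add: p_def q_def)
  then have "is_line (affine hull {p, q})"
    by (auto simp: is_line_def)
  moreover have "p \<in> affine hull {p, q}" "q \<in> affine hull {p, q}"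
    by (simp_all add: hull_inc)
  moreover have "p \<in> tangent_segment i" "q \<in> tangent_segment k" "tangent_point j u \<in> tangent_segment j"
    using \<open>u \<in> {0..2}\<close> bounds by (auto simp: tangent_segment_eq p_def q_def)
  ultimately show ?thesis by (intro that[of "affine hull {p, q}"]) blast+
qed

lemma aleph0_property_tangent_segments: "aleph0_property_lines 3 (range tangent_segment)"
  unfolding aleph0_property_lines_def
proof (intro allI impI, elim conjE)
  fix S :: "nat \<Rightarrow> (real ^ 3) set"
  assume "inj S" "\<forall>n. S n \<in> range tangent_segment"
  then obtain f where f: "S = tangent_segment \<circ> f" by (fastforce simp: image_iff fun_eq_iff dest: choice)
  with \<open>inj S\<close> have "inj f" by (metis inj_on_imageI2)
  then have "infinite (range f)" by (rule range_inj_infinite)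
  \<comment> \<open>Arbitrarily large indices occur, so three positions with increasing indices can
    be picked; these positions are then distinct.\<close>
  then have unbounded: "\<exists>n. m < f n" for m
    by (force simp: infinite_nat_iff_unbounded)
  obtain b where b: "f 0 < f b" using unbounded by blast
  obtain c where c: "f b < f c" using unbounded by blast
  obtain L where "is_line L" "tangent_segment (f 0) \<inter> L \<noteq> {}"
    "tangent_segment (f b) \<inter> L \<noteq> {}" "tangent_segment (f c) \<inter> L \<noteq> {}"
    by (rule three_tangent_segments_transversal[OF b c])
  then have "is_line L" "\<forall>i\<in>{0, b, c}. S i \<inter> L \<noteq> {}" by (simp_all add: f)
  moreover have "card {0, b, c} = 3"
  proof -
    have "0 \<noteq> b" "0 \<noteq> c" "b \<noteq> c" using b c by (auto intro!: gr0I)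
    then show ?thesis by simp
  qed
  ultimately show "\<exists>I. finite I \<and> card I = 3 \<and> (\<exists>L. is_line L \<and> (\<forall>i\<in>I. S i \<inter> L \<noteq> {}))"
    by (intro exI [of _ "{0, b, c}"]) auto
qed

section \<open>Lines meeting infinitely many segments\<close>

lemma line_three_points:
  assumes "is_line L" "p \<in> L" "q \<in> L" "r \<in> L" "p \<noteq> q"
  obtains c where "r = p + c *\<^sub>R (q - p)"
proof -
  have "affine hull {p, q} \<subseteq> L"
    using assms by (simp add: is_line_def hull_minimal)
  then have "affine hull {p, q} = L"
    using assms by (intro affine_dim_equal) (auto simp: is_line_def)
  then obtain a c where "a + c = 1" "r = a *\<^sub>R p + c *\<^sub>R q"
    using \<open>r \<in> L\<close> by (auto simp: affine_hull_2)
  moreover from this have "a = 1 - c" by simp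
  ultimately have "r = p + c *\<^sub>R (q - p)" by (simp add: algebra_simps)
  then show ?thesis by (rule that)
qed

text \<open>Along a line, coordinate \<open>m\<close> changes at a fixed rate relative to coordinate
  \<open>l\<close>. If that rate were nonzero, \<open>m\<close> would be unbounded along with
  \<open>l\<close>.\<close>

lemma bounded_coordinate_of_line_constant:
  fixes p :: "nat \<Rightarrow> real ^ 'n"
  assumes L: "is_line L" and "infinite N" and p: "\<And>n. n \<in> N \<Longrightarrow> p n \<in> L"
    and first: "\<And>n. n \<in> N \<Longrightarrow> p n $ l = real n"
    and bounded: "\<And>n. n \<in> N \<Longrightarrow> \<bar>p n $ m\<bar> \<le> B"
    and "a \<in> N" "b \<in> N"
  shows "p a $ m = p b $ m"
proof (rule ccontr)
  assume neq: "p a $ m \<noteq> p b $ m"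
  then have "a \<noteq> b" by auto
  define D where "D = \<bar>p b $ m - p a $ m\<bar>"
  have "D > 0" using neq by (simp add: D_def)
  \<comment> \<open>The bound on coordinate \<open>m\<close> forces
    \<open>\<bar>c\<bar> \<le> 2 * B / D\<close>, so coordinate \<open>l\<close> cannot get past
    this threshold.\<close>
  obtain M where M: "real a + 2 * B * \<bar>real b - real a\<bar> / D < real M"
    using reals_Archimedean2 by blast
  obtain n where "n \<in> N" "M < n"
    using \<open>infinite N\<close> by (auto simp: infinite_nat_iff_unbounded)
  with M have n: "n \<in> N" "real n > real a + 2 * B * \<bar>real b - real a\<bar> / D"
    by auto
  from neq have "p a \<noteq> p b" by auto
  then obtain c where c: "p n = p a + c *\<^sub>R (p b - p a)"
    using line_three_points[OF L p p p] \<open>a \<in> N\<close> \<open>b \<in> N\<close> n(1) by blast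
  have "real n - real a = c * (real b - real a)"
    using arg_cong[OF c, of "\<lambda>v. v $ l"] first \<open>a \<in> N\<close> \<open>b \<in> N\<close> n(1) by simp
  then have "\<bar>c\<bar> * \<bar>real b - real a\<bar> \<ge> real n - real a"
    by (metis abs_ge_self abs_mult)
  moreover have "\<bar>c\<bar> * D \<le> 2 * B"
  proof -
    have "\<bar>c\<bar> * D = \<bar>p n $ m - p a $ m\<bar>"
      using arg_cong[OF c, of "\<lambda>v. v $ m"] by (simp add: D_def abs_mult)
    also have "\<dots> \<le> 2 * B" using bounded[OF n(1)] bounded[OF \<open>a \<in> N\<close>] by linarith
    finally show ?thesis .
  qed
  then have "\<bar>c\<bar> \<le> 2 * B / D" using \<open>D > 0\<close> by (simp add: field_simps)
  then have "\<bar>c\<bar> * \<bar>real b - real a\<bar> \<le> 2 * B / D * \<bar>real b - real a\<bar>"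
    by (rule mult_right_mono) simp
  ultimately show False using n(2) by simp
qed

lemma finite_tangent_segments_on_line:
  assumes "is_line L"
  shows "finite {n. tangent_segment n \<inter> L \<noteq> {}}" (is "finite ?N")
proof (rule ccontr)
  assume inf: "infinite ?N"
  have "\<exists>u. 0 \<le> u \<and> u \<le> 2 \<and> tangent_point n u \<in> L" if "n \<in> ?N" for n
    using that by (auto simp: tangent_segment_eq)
  then obtain u where u: "\<And>n. n \<in> ?N \<Longrightarrow> 0 \<le> u n \<and> u n \<le> 2 \<and> tangent_point n (u n) \<in> L"
    by metis
  let ?t = tangent_parameter
  obtain A where "A \<subseteq> ?N" "card A = 3"
    using infinite_arbitrarily_large[OF inf] by blast
  then obtain a b c where "A = {a, b, c}" and abc: "a \<noteq> b" "a \<noteq> c" "b \<noteq> c"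
    by (metis card_3_iff)
  with \<open>A \<subseteq> ?N\<close> have abc: "a \<in> ?N" "b \<in> ?N" "c \<in> ?N" "a \<noteq> b" "a \<noteq> c" "b \<noteq> c"
    by blast+
  have u_eq: "u m = u n" if "m \<in> ?N" "n \<in> ?N" for m n
    using bounded_coordinate_of_line_constant
      [OF assms inf, of "\<lambda>n. tangent_point n (u n)" 1 2 2, OF _ _ _ that] u
    by auto
  \<comment> \<open>A difference of a number in [0,2] and one in [0,1]; with this bound the heights
    are constant too.\<close>
  have bound: "\<bar>?t n * u n - (?t n)\<^sup>2\<bar> \<le> 2" if "n \<in> ?N" for n
  proof -
    have "0 \<le> ?t n * u n" "?t n * u n \<le> 1 * 2"
      using tangent_parameter_bounds[of n] u[OF that] by (simp, intro mult_mono) auto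
    moreover have "0 \<le> (?t n)\<^sup>2" "(?t n)\<^sup>2 \<le> 1"
      using tangent_parameter_bounds[of n] by (auto simp: power_le_one)
    ultimately show ?thesis by linarith
  qed
  have height_eq: "?t m * u m - (?t m)\<^sup>2 = ?t n * u n - (?t n)\<^sup>2" if "m \<in> ?N" "n \<in> ?N" for m n
    using bounded_coordinate_of_line_constant
      [OF assms inf, of "\<lambda>n. tangent_point n (u n)" 1 3 2, OF _ _ _ that] u bound
    by auto
  \<comment> \<open>Two distinct tangents of equal height over \<open>u a\<close> cross there. The
    pairs \<open>a, b\<close> and \<open>a, c\<close> then force equal parameters for
    \<open>b\<close> and \<open>c\<close>.\<close>
  have "?t m + ?t n = u a" if "m \<in> ?N" "n \<in> ?N" "m \<noteq> n" for m n
  proof -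
    have "?t m \<noteq> ?t n" using that inj_tangent_parameter by (auto dest: injD)
    moreover have "?t m * u a - (?t m)\<^sup>2 = ?t n * u a - (?t n)\<^sup>2"
      using height_eq[OF that(1,2)] u_eq[OF that(1) abc(1)] u_eq[OF that(2) abc(1)] by simp
    then have "(?t m - ?t n) * (?t m + ?t n - u a) = 0"
      by (simp add: algebra_simps power2_eq_square)
    ultimately show ?thesis by simp
  qed
  from this[of a b] this[of a c] have "?t b = ?t c" using abc by simp
  then show False using abc inj_tangent_parameter by (auto dest: injD)
qed

theorem theorem14:
  "\<exists>F :: (real ^ 3) set set.
     infinite F \<and>
     (\<forall>C\<in>F. C \<noteq> {} \<and> compact C \<and> convex C) \<and>
     k_unbounded 1 F \<and>
     aleph0_property_lines 3 F \<and>
     \<not> finite_line_transversal F"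
proof (intro exI [of _ "range tangent_segment"] conjI)
  show "infinite (range tangent_segment)"
    using inj_tangent_segment by (rule range_inj_infinite)
  show "\<forall>C\<in>range tangent_segment. C \<noteq> {} \<and> compact C \<and> convex C"
    by (auto simp: tangent_segment_def)
  show "\<not> finite_line_transversal (range tangent_segment)"
  proof
    assume "finite_line_transversal (range tangent_segment)"
    then obtain \<L> where "finite \<L>" "\<forall>L\<in>\<L>. is_line L"
      and "\<forall>n. \<exists>L\<in>\<L>. tangent_segment n \<inter> L \<noteq> {}"
      by (auto simp: finite_line_transversal_def)
    \<comment> \<open>Finitely many lines, each meeting only finitely many segments, would have to
      account for all indices.\<close>
    then have "finite (\<Union>L\<in>\<L>. {n. tangent_segment n \<inter> L \<noteq> {}})"
      "(\<Union>L\<in>\<L>. {n. tangent_segment n \<inter> L \<noteq> {}}) = UNIV"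
      using finite_tangent_segments_on_line by auto
    then show False by simp
  qed
qed (rule k_unbounded_tangent_segments aleph0_property_tangent_segments)+

end
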